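(* Let $H_N$ be a Hadamard matrix of order $N$ that is partitioned into block matrices as $$H_N = \begin{bmatrix} D & E \\ V & C \end{bmatrix},$$ where $D$ and $C$ are square matrices of order $n$ and $d$ respectively (so $n+d=N$), with $n \geq d$. Then: (1) $|\det(D)| = N^{\frac{n-d}{2}}\,|\det(C)|$. (2) If $D$ is invertible, then $C$ is also invertible and the inverse of $D$ is given by $$D^{-1} = \frac{1}{N}\left[D - E C^{-1} V\right]^T.$$
   Context: A Hadamard matrix of order $N$ is an $N\times N$ matrix $H_N$ with all entries in $\{-1,1\}$ satisfying $H_N H_N^T = H_N^T H_N = N I_N$. In the block partition, $E$ is $n\times d$ and $V$ is $d\times n$. *)

theory Defs
  imports
    Complex_Main
    "Jordan_Normal_Form.Matrix"
    "Jordan_Normal_Form.Determinant"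
    "Jordan_Normal_Form.Gauss_Jordan_Elimination"
begin

definition hadamard_mat :: "nat \<Rightarrow> real mat \<Rightarrow> bool" where
  "hadamard_mat N H \<longleftrightarrow>
     H \<in> carrier_mat N N \<and>
     (\<forall>i<N. \<forall>j<N. H $$ (i, j) \<in> {-1, 1}) \<and>
     H * transpose_mat H = real N \<cdot>\<^sub>m 1\<^sub>m N \<and>
     transpose_mat H * H = real N \<cdot>\<^sub>m 1\<^sub>m N"

end

theory Submission
  imports Defs
begin

text \<open>Write X' for the transpose of X. Comparing blocks in H H' = N I gives D D' + E E' = N I,
  V D' + C E' = 0, D V' + E C' = 0 and V V' + C C' = N I. Hence multiplying H on the right by the
  block matrix with rows (I, V') and (0, C') yields the block matrix with rows (D, 0) and (V, N I);
  determinants then give (det H) (det C) = N^d (det D), where (det H)^2 = N^N.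
  If B is the inverse of C, then (D - E B V) D' = D D' + E B C E' = N I.\<close>

text \<open>Serves to split one identity for \<open>H * H\<^sup>T\<close> into four block
  identities. Both sides share their block dimensions, so an index shifted by \<open>n1\<close> or
  \<open>m1\<close> meets the same block on either side.\<close>

lemma four_block_mat_eq_iff:
  assumes "A \<in> carrier_mat n1 m1" "B \<in> carrier_mat n1 m2"
    and "C \<in> carrier_mat n2 m1" "D \<in> carrier_mat n2 m2"
    and "A' \<in> carrier_mat n1 m1" "B' \<in> carrier_mat n1 m2"
    and "C' \<in> carrier_mat n2 m1" "D' \<in> carrier_mat n2 m2"
  shows "four_block_mat A B C D = four_block_mat A' B' C' D' \<longleftrightarrow>
    A = A' \<and> B = B' \<and> C = C' \<and> D = D'" (is "?M = ?M' \<longleftrightarrow> _")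
proof
  assume "?M = ?M'"
  then have eq: "?M $$ (i, j) = ?M' $$ (i, j)" for i j by simp
  have "A $$ (i, j) = A' $$ (i, j)" if "i < n1" "j < m1" for i j
    using eq[of i j] that assms by auto
  moreover have "B $$ (i, j) = B' $$ (i, j)" if "i < n1" "j < m2" for i j
    using eq[of i "m1 + j"] that assms by auto
  moreover have "C $$ (i, j) = C' $$ (i, j)" if "i < n2" "j < m1" for i j
    using eq[of "n1 + i" j] that assms by auto
  moreover have "D $$ (i, j) = D' $$ (i, j)" if "i < n2" "j < m2" for i j
    using eq[of "n1 + i" "m1 + j"] that assms by auto
  ultimately show "A = A' \<and> B = B' \<and> C = C' \<and> D = D'"
    using assms by (auto intro!: eq_matI)
qed simp

lemma invertible_mat_iff_det:
  fixes A :: "'a :: field mat"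
  assumes A: "A \<in> carrier_mat n n"
  shows "invertible_mat A \<longleftrightarrow> det A \<noteq> 0"
proof
  assume "invertible_mat A"
  then obtain B where AB: "A * B = 1\<^sub>m n" and BA: "B * A = 1\<^sub>m (dim_row B)"
    using A by (auto simp: invertible_mat_def inverts_mat_def)
  \<comment> \<open>The inverse \<open>B\<close> comes without dimensions. Column counts in
    \<open>AB\<close> fix its width, and in \<open>BA\<close> its height.\<close>
  from arg_cong[OF AB, of dim_col] arg_cong[OF BA, of dim_col]
  have B: "B \<in> carrier_mat n n" using A by auto
  have "det A * det B = 1" using det_mult[OF A B] AB by simp
  then show "det A \<noteq> 0" by auto
next
  assume "det A \<noteq> 0"
  from det_non_zero_imp_unit[OF A this, of "()"]
  obtain B where "B \<in> carrier_mat n n" "A * B = 1\<^sub>m n" "B * A = 1\<^sub>m n"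
    by (auto simp: Units_def ring_mat_def)
  then show "invertible_mat A"
    using A by (auto simp: invertible_mat_def inverts_mat_def)
qed

text \<open>Over a field a right inverse of a square matrix is two-sided, so \<open>A\<close> is a
  unit and \<open>None\<close> cannot occur; any \<open>B'\<close> that is returned equals
  \<open>B' * A * B = B\<close>.\<close>

lemma mat_inverse_eq_SomeI:
  fixes A :: "'a :: field mat"
  assumes A: "A \<in> carrier_mat n n" and B: "B \<in> carrier_mat n n" and AB: "A * B = 1\<^sub>m n"
  shows "mat_inverse A = Some B"
proof (cases "mat_inverse A")
  case None
  have "B * A = 1\<^sub>m n" by (rule mat_mult_left_right_inverse[OF A B AB])
  then have "A \<in> Units (ring_mat TYPE('a) n ())"
    using A B AB by (auto simp: Units_def ring_mat_def)
  with mat_inverse(1)[OF A None, of "()"] show ?thesis by blast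
next
  case (Some B')
  note B' = mat_inverse(2)[OF A Some]
  have "B' = B' * (A * B)" using AB B' right_mult_one_mat[of B' n n] by simp
  also have "\<dots> = B' * A * B" using assoc_mult_mat[of B' n n A n B n] A B B' by simp
  also have "\<dots> = B" using B' left_mult_one_mat[OF B] by simp
  finally show ?thesis using Some by simp
qed

text \<open>Determinants of both sides give \<open>(det H)\<^sup>2 = r ^ N\<close>. The root is a
  real power because N may be odd.\<close>

lemma abs_det_eq_powr_half:
  fixes H :: "real mat"
  assumes H: "H \<in> carrier_mat N N" and "H * H\<^sup>T = r \<cdot>\<^sub>m 1\<^sub>m N" and r: "0 < r"
  shows "\<bar>det H\<bar> = r powr (real N / 2)"
proof -
  have "(det H)\<^sup>2 = r ^ N"
    using arg_cong[OF assms(2), of det] det_mult[OF H, of "H\<^sup>T"] det_transpose[OF H] H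
    by (simp add: power2_eq_square)
  also have "\<dots> = (r powr (real N / 2))\<^sup>2"
    using r by (simp add: power2_eq_square flip: powr_add powr_realpow)
  finally have "\<bar>det H\<bar>\<^sup>2 = (r powr (real N / 2))\<^sup>2" by simp
  then show ?thesis by (rule power2_eq_imp_eq) auto
qed

theorem theorem1:
  fixes N n d :: nat
    and H D E V C :: "real mat"
  assumes "0 < N"
    and "hadamard_mat N H"
    and "D \<in> carrier_mat n n"
    and "E \<in> carrier_mat n d"
    and "V \<in> carrier_mat d n"
    and "C \<in> carrier_mat d d"
    and "n + d = N"
    and "H = four_block_mat D E V C"
    and "d \<le> n"
  shows "\<bar>det D\<bar> = real N powr ((real n - real d) / 2) * \<bar>det C\<bar> \<and>
    (invertible_mat D \<longrightarrow>
       invertible_mat C \<and>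
       (\<exists>C'. mat_inverse C = Some C' \<and>
             mat_inverse D = Some ((1 / real N) \<cdot>\<^sub>m transpose_mat (D - E * C' * V))))"
proof -
  note D = assms(3) and E = assms(4) and V = assms(5) and C = assms(6)
    and Nnd = assms(7) and Hdef = assms(8)
  let ?r = "real N"
  have H: "H \<in> carrier_mat N N" and HHT: "H * H\<^sup>T = ?r \<cdot>\<^sub>m 1\<^sub>m N"
    using assms(2) by (auto simp: hadamard_mat_def)
  have T: "D\<^sup>T \<in> carrier_mat n n" "E\<^sup>T \<in> carrier_mat d n" "V\<^sup>T \<in> carrier_mat n d"
      "C\<^sup>T \<in> carrier_mat d d"
    using D E V C by auto
  have "four_block_mat (D * D\<^sup>T + E * E\<^sup>T) (D * V\<^sup>T + E * C\<^sup>T)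
      (V * D\<^sup>T + C * E\<^sup>T) (V * V\<^sup>T + C * C\<^sup>T) = H * H\<^sup>T"
    unfolding Hdef transpose_four_block_mat[OF D E V C]
    by (rule mult_four_block_mat[symmetric, OF D E V C T(1,3,2,4)])
  also have "\<dots> = four_block_mat (?r \<cdot>\<^sub>m 1\<^sub>m n) (0\<^sub>m n d) (0\<^sub>m d n) (?r \<cdot>\<^sub>m 1\<^sub>m d)"
    unfolding HHT by (rule eq_matI) (auto simp flip: Nnd)
  finally have DE: "D * D\<^sup>T + E * E\<^sup>T = ?r \<cdot>\<^sub>m 1\<^sub>m n"
    and DV: "D * V\<^sup>T + E * C\<^sup>T = 0\<^sub>m n d"
    and VD: "V * D\<^sup>T + C * E\<^sup>T = 0\<^sub>m d n"
    and VC: "V * V\<^sup>T + C * C\<^sup>T = ?r \<cdot>\<^sub>m 1\<^sub>m d"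
    using four_block_mat_eq_iff[of "D * D\<^sup>T + E * E\<^sup>T" n n "D * V\<^sup>T + E * C\<^sup>T" d
        "V * D\<^sup>T + C * E\<^sup>T" d "V * V\<^sup>T + C * C\<^sup>T" "?r \<cdot>\<^sub>m 1\<^sub>m n" "0\<^sub>m n d" "0\<^sub>m d n" "?r \<cdot>\<^sub>m 1\<^sub>m d"] D E V C
    by simp_all
  \<comment> \<open>The right block column of \<open>?M\<close> is the transpose of the lower block
    row of \<open>H\<close>, so \<open>DV\<close> and \<open>VC\<close> evaluate the right block
    column of the product.\<close>
  let ?M = "four_block_mat (1\<^sub>m n) (V\<^sup>T) (0\<^sub>m d n) (C\<^sup>T)"
  have "H * ?M = four_block_mat D (0\<^sub>m n d) V (?r \<cdot>\<^sub>m 1\<^sub>m d)"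
    unfolding Hdef
    by (subst mult_four_block_mat[OF D E V C one_carrier_mat T(3) zero_carrier_mat T(4)])
      (use D E V C in \<open>simp add: DV VC\<close>)
  then have "det H * det ?M = det (four_block_mat D (0\<^sub>m n d) V (?r \<cdot>\<^sub>m 1\<^sub>m d))"
    using det_mult[OF H, of ?M] C Nnd by auto
  moreover have "det ?M = det C"
    using det_four_block_mat_lower_left_zero[OF one_carrier_mat T(3) refl T(4)] det_transpose[OF C]
    by simp
  moreover have "det (four_block_mat D (0\<^sub>m n d) V (?r \<cdot>\<^sub>m 1\<^sub>m d)) = det D * ?r ^ d"
    using det_four_block_mat_upper_right_zero[OF D refl V, of "?r \<cdot>\<^sub>m 1\<^sub>m d"] by simp
  ultimately have "\<bar>det H\<bar> * \<bar>det C\<bar> = \<bar>det D\<bar> * ?r ^ d"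
    by (metis abs_mult abs_of_nonneg of_nat_0_le_iff zero_le_power)
  moreover have "\<bar>det H\<bar> = ?r powr ((real n - real d) / 2) * ?r ^ d"
  proof -
    have "\<bar>det H\<bar> = ?r powr (real N / 2)"
      using abs_det_eq_powr_half[OF H HHT] assms(1) by simp
    \<comment> \<open>The exponent is split so that the factor \<open>?r ^ d\<close> cancels against
      the one multiplying \<open>\<bar>det D\<bar>\<close>; it is nonzero since N is
      positive.\<close>
    also have "real N / 2 = (real n - real d) / 2 + real d"
      by (simp add: field_simps flip: Nnd)
    finally show ?thesis using assms(1) by (simp add: powr_add powr_realpow)
  qed
  ultimately have det: "\<bar>det D\<bar> = ?r powr ((real n - real d) / 2) * \<bar>det C\<bar>"
    using assms(1) by simp
  have "invertible_mat C \<and> (\<exists>C'. mat_inverse C = Some C' \<and>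
      mat_inverse D = Some ((1 / ?r) \<cdot>\<^sub>m (D - E * C' * V)\<^sup>T))" if "invertible_mat D"
  proof -
    \<comment> \<open>By the determinant formula, \<open>det C = 0\<close> would force
      \<open>det D = 0\<close>.\<close>
    have "det C \<noteq> 0" using that det invertible_mat_iff_det[OF D] by auto
    then have inv: "invertible_mat C" using invertible_mat_iff_det[OF C] by simp
    from det_non_zero_imp_unit[OF C \<open>det C \<noteq> 0\<close>, of "()"]
    obtain C' where C': "C' \<in> carrier_mat d d" and CC': "C * C' = 1\<^sub>m d" and C'C: "C' * C = 1\<^sub>m d"
      by (auto simp: Units_def ring_mat_def)
    \<comment> \<open>This is the Schur complement of \<open>C\<close> in \<open>H\<close>.\<close>
    let ?S = "D - E * C' * V"
    have S: "?S \<in> carrier_mat n n" using D E V C' by auto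
    \<comment> \<open>\<open>VD\<close> solved for its first summand, entry by entry over the reals.
      With it, the factor \<open>C' * C\<close> appears in \<open>E * C' * V * D\<^sup>T\<close> and
      cancels.\<close>
    have CE: "V * D\<^sup>T = - (C * E\<^sup>T)"
    proof (rule eq_matI)
      fix i j assume "i < dim_row (- (C * E\<^sup>T))" "j < dim_col (- (C * E\<^sup>T))"
      then show "(V * D\<^sup>T) $$ (i, j) = (- (C * E\<^sup>T)) $$ (i, j)"
        using arg_cong[OF VD, of "\<lambda>M. M $$ (i, j)"] D E V C by (simp add: eq_neg_iff_add_eq_0)
    qed (use D E V C in auto)
    have "E * C' * V * D\<^sup>T = E * C' * (V * D\<^sup>T)"
      by (rule assoc_mult_mat[OF _ V T(1)]) (use E C' in auto)
    also have "\<dots> = - (E * C' * (C * E\<^sup>T))"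
      unfolding CE using E C C' by simp
    also have "E * C' * (C * E\<^sup>T) = E * (C' * (C * E\<^sup>T))"
      using E C C' by (intro assoc_mult_mat) auto
    also have "C' * (C * E\<^sup>T) = E\<^sup>T"
      using E C C' C'C by (simp flip: assoc_mult_mat[of C' d d C d "E\<^sup>T" n])
    finally have "?S * D\<^sup>T = D * D\<^sup>T - (- (E * E\<^sup>T))"
      using minus_mult_distrib_mat[OF D _ T(1), of "E * C' * V"] E C' V by simp
    also have "\<dots> = D * D\<^sup>T + E * E\<^sup>T" using D E by auto
    finally have "?S * D\<^sup>T = ?r \<cdot>\<^sub>m 1\<^sub>m n" using DE by simp
    \<comment> \<open>Scalar matrices are symmetric, so transposing moves \<open>D\<close> to the
      left and exhibits a right inverse of \<open>D\<close>. This is where the transpose in the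
      formula for the inverse comes from.\<close>
    then have "(?S * D\<^sup>T)\<^sup>T = ?r \<cdot>\<^sub>m 1\<^sub>m n" by auto
    then have "D * ?S\<^sup>T = ?r \<cdot>\<^sub>m 1\<^sub>m n" using transpose_mult[OF S T(1)] by simp
    then have "D * ((1 / ?r) \<cdot>\<^sub>m ?S\<^sup>T) = (1 / ?r) \<cdot>\<^sub>m (?r \<cdot>\<^sub>m 1\<^sub>m n)"
      using mult_smult_distrib[OF D, of "?S\<^sup>T" n] S by simp
    also have "\<dots> = 1\<^sub>m n" using assms(1) by auto
    finally have "mat_inverse D = Some ((1 / ?r) \<cdot>\<^sub>m ?S\<^sup>T)"
      using mat_inverse_eq_SomeI[OF D] S by simp
    \<comment> \<open>The inverse \<open>C'\<close> obtained from the unit group is also the value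
      of \<open>mat_inverse C\<close>, so the same witness serves both equations.\<close>
    then show ?thesis using inv mat_inverse_eq_SomeI[OF C C' CC'] by blast
  qed
  with det show ?thesis by blast
qed

end
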